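(* Let $n\ge 2$ and let $$y^{(n)}+A_n^2\,y^{(n-2)}+\dots+A_n^j\,y^{(n-j)}+\dots+A_n^n\,y=0$$ be a linear iterative equation in normal form, and put $\mathfrak{q}=A_n^2/\binom{n+1}{3}$. Let $u$ be a nowhere vanishing solution (on the interval considered) of the second-order source equation $y''+\mathfrak{q}\,y=0$, and let $\lambda$ be a nonzero constant. Then the point transformation $$z=\int\frac{dx}{u^2},\qquad y=\frac{1}{\lambda}\,u^{\,n-1}\,w$$ reduces the given equation in $y=y(x)$ to the canonical form $w^{(n)}(z)=0$.
   Context: All functions are smooth functions of $x$ and all considerations are local (on sufficiently small intervals). Superscripts on $A_n^j$ are indices, not powers; $\int \frac{dx}{u^2}$ denotes a fixed antiderivative of $1/u^2$. Two equations differing by multiplication by a nowhere vanishing function of the independent variable are regarded as the same equation. Iterative equations: let $r$ (nowhere zero) and $s$ be smooth functions of $x$, and let $\Psi=r\frac{d}{dx}+s$, so $\Psi[y]=ry'+sy$. Put $\Psi^0=I$ (identity) and $\Psi^n[y]=\Psi^{n-1}(\Psi[y])$ for $n\ge1$. A linear equation of order $n$ is called iterative if it is of the form $\Psi^n[y]=0$ for some such $r,s$. *)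

theory Defs
  imports "HOL-Analysis.Analysis"
begin

(* Functions are total on the reals, but only their values on an open set S matter:
   iterated deriv at a point of S depends only on the germ there. *)
definition smooth_on :: "real set \<Rightarrow> (real \<Rightarrow> real) \<Rightarrow> bool" where
  "smooth_on S f \<longleftrightarrow> (\<forall>k. \<forall>x\<in>S. (deriv ^^ k) f field_differentiable (at x))"

(* A linear homogeneous equation L[y] = 0 is represented by its left-hand side L. *)
type_synonym ode = "(real \<Rightarrow> real) \<Rightarrow> real \<Rightarrow> real"

(* Equality of equations on S, up to a nowhere vanishing factor of the independent variable. *)
definition same_equation :: "real set \<Rightarrow> ode \<Rightarrow> ode \<Rightarrow> bool" where
  "same_equation S L M \<longleftrightarrow>
     (\<exists>\<mu>. smooth_on S \<mu> \<and> (\<forall>x\<in>S. \<mu> x \<noteq> 0) \<and>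
          (\<forall>y. smooth_on S y \<longrightarrow> (\<forall>x\<in>S. L y x = \<mu> x * M y x)))"

definition normal_form :: "nat \<Rightarrow> (nat \<Rightarrow> real \<Rightarrow> real) \<Rightarrow> ode" where
  "normal_form n A y x =
     (deriv ^^ n) y x + (\<Sum>j=2..n. A j x * (deriv ^^ (n - j)) y x)"

definition Psi :: "(real \<Rightarrow> real) \<Rightarrow> (real \<Rightarrow> real) \<Rightarrow> ode" where
  "Psi r s y x = r x * deriv y x + s x * y x"

definition iterative :: "real set \<Rightarrow> nat \<Rightarrow> ode \<Rightarrow> bool" where
  "iterative S n L \<longleftrightarrow>
     (\<exists>r s. smooth_on S r \<and> (\<forall>x\<in>S. r x \<noteq> 0) \<and> smooth_on S s \<and>
            same_equation S (Psi r s ^^ n) L)"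

definition source_coeff :: "nat \<Rightarrow> (nat \<Rightarrow> real \<Rightarrow> real) \<Rightarrow> real \<Rightarrow> real" where
  "source_coeff n A x = A 2 x / real ((n + 1) choose 3)"

(* The point transformation z = \<phi>(x), y = h(x) w; it is an invertible change of
   variables (x, y) \<longleftrightarrow> (z, w) over S. *)
definition point_transformation ::
  "real set \<Rightarrow> (real \<Rightarrow> real) \<Rightarrow> (real \<Rightarrow> real) \<Rightarrow> bool" where
  "point_transformation S \<phi> h \<longleftrightarrow>
     smooth_on S \<phi> \<and> inj_on \<phi> S \<and> open (\<phi> ` S) \<and>
     smooth_on (\<phi> ` S) (the_inv_into S \<phi>) \<and>
     smooth_on S h \<and> (\<forall>x\<in>S. h x \<noteq> 0)"

(* The equation for w = w(z), z in \<phi> ` S, obtained by substituting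
   y(x) = h(x) w(\<phi>(x)) into L[y] = 0. *)
definition transformed_equation ::
  "real set \<Rightarrow> (real \<Rightarrow> real) \<Rightarrow> (real \<Rightarrow> real) \<Rightarrow> ode \<Rightarrow> ode" where
  "transformed_equation S \<phi> h L w z =
     L (\<lambda>x. h x * w (\<phi> x)) (the_inv_into S \<phi> z)"

definition reduces_to ::
  "real set \<Rightarrow> (real \<Rightarrow> real) \<Rightarrow> (real \<Rightarrow> real) \<Rightarrow> ode \<Rightarrow> ode \<Rightarrow> bool" where
  "reduces_to S \<phi> h L M \<longleftrightarrow>
     point_transformation S \<phi> h \<and>
     same_equation (\<phi> ` S) (transformed_equation S \<phi> h L) M"

end

theory Submission
  imports Defs
begin

text \<open>
  Both the iterative equation and the transformed canonical equation are products of first-order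
  operators of the same shape
  \[ (D - (m - 2(n-1))p) \cdots (D - (m-2)p)\,(D - m p), \qquad m = n - 1, \quad p' = -q - p^2, \]
  and such a product depends on \<open>q\<close> only, although \<open>p\<close> ranges over a one-parameter family of
  solutions of the Riccati equation.

  On the iterative side, dividing \<open>\<Psi>\<^sup>n\<close> by \<open>r\<^sup>n\<close> gives the product of the operators
  \<open>D + s/r + i r'/r\<close> (\<open>Psi_funpow_eq_chain\<close>).  An equation determines its coefficients
  (\<open>chain_coeff_unique\<close>): the missing term of order \<open>n - 1\<close> forces \<open>s/r = -(n-1)p\<close> with
  \<open>p = r'/(2r)\<close>, and then the coefficient of order \<open>n - 2\<close>, which equals
  \<open>-(n+1 choose 3)(p' + p\<^sup>2)\<close>, turns the definition of the source coefficient \<open>q\<close> into the Riccati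
  equation for \<open>p\<close>.

  On the other side, a nowhere vanishing solution \<open>u\<close> of the source equation gives the solution
  \<open>u'/u\<close> of the same Riccati equation, and each factor of the corresponding product, applied to a
  function \<open>a u\<^sup>j w(z)\<close>, lowers \<open>j\<close> by two and differentiates \<open>w\<close> once, because \<open>z' = 1/u\<^sup>2\<close>
  (\<open>chain_riccati_point_transformation\<close>).  So the whole product turns \<open>y = u\<^sup>n\<^sup>-\<^sup>1 w(z)/\<lambda>\<close>
  into \<open>w\<^sup>(\<^sup>n\<^sup>)(z) / (\<lambda> u\<^sup>n\<^sup>+\<^sup>1)\<close>.

  That the product depends on \<open>q\<close> only is shown by comparing it with the symmetric power of the
  source equation, defined by a recursion in which \<open>p\<close> does not occur
  (\<open>chain_riccati_eq_sym_power\<close>).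
\<close>

section \<open>Smooth functions on an open set\<close>

text \<open>
  Closure of smooth functions under products, quotients, composition and inversion cannot be
  proved by a direct induction on the order of an iterated derivative, since the derivative of a
  product is a sum of other products.  Finitely many orders of differentiability, counted by this
  recursion, give an induction hypothesis that applies to all of them.
\<close>
primrec times_differentiable :: "nat \<Rightarrow> real set \<Rightarrow> (real \<Rightarrow> real) \<Rightarrow> bool" where
  "times_differentiable 0 S f = True"
| "times_differentiable (Suc k) S f =
     ((\<forall>x\<in>S. f field_differentiable (at x)) \<and> times_differentiable k S (deriv f))"

lemma times_differentiable_iff:
  "times_differentiable k S f \<longleftrightarrow> (\<forall>j<k. \<forall>x\<in>S. (deriv ^^ j) f field_differentiable (at x))"
proof (induction k arbitrary: f)
  case 0
  then show ?case by simp
next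
  case (Suc k)
  have "(\<forall>j<Suc k. P ((deriv ^^ j) f)) \<longleftrightarrow> P f \<and> (\<forall>j<k. P ((deriv ^^ j) (deriv f)))"
    for P :: "(real \<Rightarrow> real) \<Rightarrow> bool"
    by (simp add: All_less_Suc2 funpow_swap1)
  from this[of "\<lambda>g. \<forall>x\<in>S. g field_differentiable (at x)"] show ?case
    by (simp add: Suc.IH)
qed

lemma smooth_on_iff_times_differentiable:
  "smooth_on S f \<longleftrightarrow> (\<forall>k. times_differentiable k S f)"
  unfolding smooth_on_def times_differentiable_iff by blast

lemma deriv_cong_open:
  fixes f g :: "real \<Rightarrow> real"
  assumes "open S" "\<And>x. x \<in> S \<Longrightarrow> f x = g x" "x \<in> S"
  shows "deriv f x = deriv g x"
proof (rule deriv_cong_ev)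
  show "\<forall>\<^sub>F x in nhds x. f x = g x"
    using assms by (auto simp: eventually_nhds)
qed simp

lemma times_differentiable_cong:
  assumes "open S" "\<And>x. x \<in> S \<Longrightarrow> f x = g x" "times_differentiable k S f"
  shows "times_differentiable k S g"
  using assms
proof (induction k arbitrary: f g)
  case (Suc k)
  have "g field_differentiable (at x)" if "x \<in> S" for x
  proof -
    have "(f has_real_derivative deriv f x) (at x)"
      using Suc.prems(3) that by (simp add: DERIV_deriv_iff_field_differentiable)
    then have "(g has_real_derivative deriv f x) (at x)"
      by (rule has_field_derivative_transform_within_open[OF _ Suc.prems(1) that Suc.prems(2)])
    then show ?thesis by (auto simp: field_differentiable_def)
  qed
  moreover have "times_differentiable k S (deriv g)"
  proof (rule Suc.IH[OF Suc.prems(1)])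
    show "deriv f x = deriv g x" if "x \<in> S" for x
      using deriv_cong_open[OF Suc.prems(1,2) that] .
  qed (use Suc.prems(3) in simp)
  ultimately show ?case by simp
qed simp

lemma times_differentiable_SucI:
  assumes "open S" "\<And>x. x \<in> S \<Longrightarrow> (f has_real_derivative f' x) (at x)"
    "times_differentiable k S f'"
  shows "times_differentiable (Suc k) S f"
proof -
  have "times_differentiable k S (deriv f)"
    by (rule times_differentiable_cong[OF assms(1) _ assms(3)])
      (use DERIV_imp_deriv[OF assms(2)] in simp)
  then show ?thesis
    using assms(2) by (auto simp: field_differentiable_def)
qed

lemma times_differentiable_SucD:
  "times_differentiable (Suc k) S f \<Longrightarrow> times_differentiable k S f"
  by (simp only: times_differentiable_iff) auto

lemma times_differentiable_has_derivative:
  "times_differentiable (Suc k) S f \<Longrightarrow> x \<in> S \<Longrightarrow> (f has_real_derivative deriv f x) (at x)"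
  by (simp add: DERIV_deriv_iff_field_differentiable)

lemma times_differentiable_const: "times_differentiable k S (\<lambda>_. c)"
  by (induction k arbitrary: c) auto

lemma times_differentiable_add:
  assumes "open S" "times_differentiable k S f" "times_differentiable k S g"
  shows "times_differentiable k S (\<lambda>x. f x + g x)"
  using assms
proof (induction k arbitrary: f g)
  case (Suc k)
  have "times_differentiable k S (\<lambda>x. deriv f x + deriv g x)"
    using Suc.prems by (intro Suc.IH) auto
  moreover have "((\<lambda>x. f x + g x) has_real_derivative deriv f x + deriv g x) (at x)"
    if "x \<in> S" for x
    using Suc.prems that by (intro DERIV_add times_differentiable_has_derivative)
  ultimately show ?case
    using Suc.prems(1) by (intro times_differentiable_SucI)
qed simp

lemma times_differentiable_mult:
  assumes "open S" "times_differentiable k S f" "times_differentiable k S g"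
  shows "times_differentiable k S (\<lambda>x. f x * g x)"
  using assms
proof (induction k arbitrary: f g)
  case (Suc k)
  note fg = Suc.prems(2,3)[THEN times_differentiable_SucD]
  have "times_differentiable k S (\<lambda>x. deriv f x * g x + deriv g x * f x)"
    using Suc.prems fg by (intro times_differentiable_add Suc.IH) auto
  moreover have "((\<lambda>x. f x * g x) has_real_derivative deriv f x * g x + deriv g x * f x) (at x)"
    if "x \<in> S" for x
    using Suc.prems that by (intro DERIV_mult times_differentiable_has_derivative)
  ultimately show ?case
    using Suc.prems(1) by (intro times_differentiable_SucI)
qed simp

lemma times_differentiable_inverse:
  assumes "open S" "times_differentiable k S f" "\<And>x. x \<in> S \<Longrightarrow> f x \<noteq> 0"
  shows "times_differentiable k S (\<lambda>x. inverse (f x))"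
  using assms
proof (induction k)
  case (Suc k)
  have inv: "times_differentiable k S (\<lambda>x. inverse (f x))"
    by (rule Suc.IH[OF Suc.prems(1) times_differentiable_SucD[OF Suc.prems(2)] Suc.prems(3)])
  have "times_differentiable k S (\<lambda>x. - 1 * (inverse (f x) * deriv f x * inverse (f x)))"
    using Suc.prems inv
    by (intro times_differentiable_mult times_differentiable_const) auto
  moreover have "((\<lambda>x. inverse (f x)) has_real_derivative
      - 1 * (inverse (f x) * deriv f x * inverse (f x))) (at x)" if "x \<in> S" for x
    using DERIV_inverse'[OF times_differentiable_has_derivative[OF Suc.prems(2) that]
        Suc.prems(3)[OF that]]
    by simp
  ultimately show ?case
    using Suc.prems(1) by (intro times_differentiable_SucI)
qed simp

lemma times_differentiable_compose:
  assumes "open S" "times_differentiable k T f" "times_differentiable k S g"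
    "\<And>x. x \<in> S \<Longrightarrow> g x \<in> T"
  shows "times_differentiable k S (\<lambda>x. f (g x))"
  using assms
proof (induction k arbitrary: f)
  case (Suc k)
  have "times_differentiable k S (\<lambda>x. deriv f (g x))"
    by (rule Suc.IH[OF Suc.prems(1) _ times_differentiable_SucD[OF Suc.prems(3)] Suc.prems(4)])
      (use Suc.prems(2) in auto)
  then have "times_differentiable k S (\<lambda>x. deriv f (g x) * deriv g x)"
    using Suc.prems by (intro times_differentiable_mult) auto
  moreover have "((\<lambda>x. f (g x)) has_real_derivative deriv f (g x) * deriv g x) (at x)"
    if "x \<in> S" for x
    by (rule DERIV_chain2[OF times_differentiable_has_derivative[OF Suc.prems(2) Suc.prems(4)[OF that]]
          times_differentiable_has_derivative[OF Suc.prems(3) that]])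
  ultimately show ?case
    using Suc.prems(1) by (intro times_differentiable_SucI)
qed simp

lemma smooth_on_has_derivative:
  "smooth_on S f \<Longrightarrow> x \<in> S \<Longrightarrow> (f has_real_derivative deriv f x) (at x)"
  by (simp add: smooth_on_def DERIV_deriv_iff_field_differentiable) (metis funpow_0)

lemma smooth_on_deriv: "smooth_on S f \<Longrightarrow> smooth_on S (deriv f)"
  unfolding smooth_on_iff_times_differentiable by (metis times_differentiable.simps(2))

lemma smooth_on_higher_deriv: "smooth_on S f \<Longrightarrow> smooth_on S ((deriv ^^ k) f)"
  by (induction k) (auto intro: smooth_on_deriv)

lemma smooth_onI_deriv:
  assumes "open S" "\<And>x. x \<in> S \<Longrightarrow> (f has_real_derivative f' x) (at x)" "smooth_on S f'"
  shows "smooth_on S f"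
  unfolding smooth_on_iff_times_differentiable
proof
  fix k
  have "times_differentiable (Suc k) S f"
    using assms by (intro times_differentiable_SucI)
      (auto simp: smooth_on_iff_times_differentiable)
  then show "times_differentiable k S f" by (rule times_differentiable_SucD)
qed

lemma smooth_on_const: "smooth_on S (\<lambda>_. c)"
  by (simp add: smooth_on_iff_times_differentiable times_differentiable_const)

lemma smooth_on_add:
  "open S \<Longrightarrow> smooth_on S f \<Longrightarrow> smooth_on S g \<Longrightarrow> smooth_on S (\<lambda>x. f x + g x)"
  by (simp add: smooth_on_iff_times_differentiable times_differentiable_add)

lemma smooth_on_mult:
  "open S \<Longrightarrow> smooth_on S f \<Longrightarrow> smooth_on S g \<Longrightarrow> smooth_on S (\<lambda>x. f x * g x)"
  by (simp add: smooth_on_iff_times_differentiable times_differentiable_mult)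

lemma smooth_on_power: "open S \<Longrightarrow> smooth_on S f \<Longrightarrow> smooth_on S (\<lambda>x. f x ^ k)"
  by (induction k) (auto intro: smooth_on_const smooth_on_mult)

lemma smooth_on_divide:
  "open S \<Longrightarrow> smooth_on S f \<Longrightarrow> smooth_on S g \<Longrightarrow> (\<And>x. x \<in> S \<Longrightarrow> g x \<noteq> 0)
    \<Longrightarrow> smooth_on S (\<lambda>x. f x / g x)"
  by (simp add: smooth_on_iff_times_differentiable times_differentiable_mult
      times_differentiable_inverse divide_inverse)

lemma smooth_on_compose:
  "open S \<Longrightarrow> smooth_on T f \<Longrightarrow> smooth_on S g \<Longrightarrow> (\<And>x. x \<in> S \<Longrightarrow> g x \<in> T)
    \<Longrightarrow> smooth_on S (\<lambda>x. f (g x))"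
  using times_differentiable_compose unfolding smooth_on_iff_times_differentiable by blast

text \<open>
  The derivative \<open>1 / f'(g)\<close> of the inverse function \<open>g\<close> is as often differentiable as \<open>g\<close> itself,
  so each order of differentiability of \<open>g\<close> yields the next one.
\<close>
lemma smooth_on_inverse_function:
  assumes "open S" "is_interval S" "smooth_on S f" "\<And>x. x \<in> S \<Longrightarrow> deriv f x > 0"
  shows "inj_on f S" "open (f ` S)" "smooth_on (f ` S) (the_inv_into S f)"
proof -
  note D = smooth_on_has_derivative[OF assms(3)]
  have "f x < f y" if "x \<in> S" "y \<in> S" "x < y" for x y
  proof (rule DERIV_pos_imp_increasing[OF that(3)])
    fix t assume "x \<le> t" "t \<le> y"
    then have "t \<in> S" using that assms(2) mem_is_interval_1_I by blast
    then show "\<exists>d. DERIV f t :> d \<and> d > 0" using D assms(4) by blast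
  qed
  then show inj: "inj_on f S"
    by (intro linorder_inj_onI) (auto simp: less_imp_neq)
  have cont: "continuous_on S f"
    using D by (meson DERIV_continuous_on has_field_derivative_at_within)
  show op: "open (f ` S)"
    using injective_eq_1d_open_map_UNIV[OF cont assms(2)] inj assms(1) by blast
  let ?g = "the_inv_into S f"
  have g: "?g y \<in> S" "f (?g y) = y" if "y \<in> f ` S" for y
    using that inj by (auto simp: the_inv_into_f_f)
  have Dg: "(?g has_real_derivative inverse (deriv f (?g y))) (at y)" if "y \<in> f ` S" for y
  proof -
    have "(?g has_real_derivative inverse (deriv f (?g y))) (at (f (?g y)))"
      unfolding has_field_derivative_def
    proof (rule has_derivative_inverse_strong[OF assms(1) g(1)[OF that] cont])
      show "(f has_derivative (*) (deriv f (?g y))) (at (?g y))"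
        using D[OF g(1)[OF that]] by (simp add: has_field_derivative_def)
      show "(*) (deriv f (?g y)) \<circ> (*) (inverse (deriv f (?g y))) = id"
        using assms(4)[OF g(1)[OF that]] by auto
    qed (simp add: the_inv_into_f_f inj)
    then show ?thesis using g[OF that] by simp
  qed
  have "times_differentiable k (f ` S) ?g" for k
  proof (induction k)
    case (Suc k)
    have "times_differentiable k S (deriv f)"
      using smooth_on_deriv[OF assms(3)] by (simp add: smooth_on_iff_times_differentiable)
    then have "times_differentiable k (f ` S) (\<lambda>y. deriv f (?g y))"
      using g(1) by (rule times_differentiable_compose[OF op _ Suc])
    then have "times_differentiable k (f ` S) (\<lambda>y. inverse (deriv f (?g y)))"
      using assms(4)[OF g(1)] by (intro times_differentiable_inverse op) (auto simp: less_le)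
    then show ?case
      by (intro times_differentiable_SucI[OF op Dg]) auto
  qed simp
  then show "smooth_on (f ` S) ?g"
    by (simp add: smooth_on_iff_times_differentiable)
qed

section \<open>Products of first-order operators\<close>

text \<open>The product \<open>(D + c\<^sub>k\<^sub>-\<^sub>1) \<cdots> (D + c\<^sub>1)(D + c\<^sub>0)\<close>; the factor \<open>D + c\<^sub>0\<close> acts first.\<close>
primrec chain :: "(nat \<Rightarrow> real \<Rightarrow> real) \<Rightarrow> nat \<Rightarrow> ode" where
  "chain c 0 = (\<lambda>y. y)"
| "chain c (Suc k) = (\<lambda>y x. deriv (chain c k y) x + c k x * chain c k y x)"

lemma smooth_on_chain:
  assumes "open S" "\<And>i. smooth_on S (c i)" "smooth_on S y"
  shows "smooth_on S (chain c k y)"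
proof (induction k)
  case (Suc k)
  have "smooth_on S (\<lambda>x. c k x * chain c k y x)"
    by (rule smooth_on_mult[OF assms(1) assms(2) Suc])
  with smooth_on_deriv[OF Suc] show ?case
    unfolding chain.simps by (rule smooth_on_add[OF assms(1)])
qed (use assms(3) in simp)

lemma chain_cong:
  assumes "open S" "\<And>i x. x \<in> S \<Longrightarrow> c i x = d i x" "x \<in> S"
  shows "chain c k y x = chain d k y x"
  using assms(3)
proof (induction k arbitrary: x)
  case (Suc k)
  have "deriv (chain c k y) x = deriv (chain d k y) x"
    by (rule deriv_cong_open[OF assms(1) Suc.IH Suc.prems])
  then show ?case using Suc assms(2) by simp
qed simp

text \<open>
  Coefficients of the expanded product, indexed from the leading one (\<open>j\<close> belongs to the
  derivative of order \<open>k - j\<close>), so that the three top coefficients obey recursions among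
  themselves.
\<close>
primrec chain_coeff :: "(nat \<Rightarrow> real \<Rightarrow> real) \<Rightarrow> nat \<Rightarrow> nat \<Rightarrow> real \<Rightarrow> real" where
  "chain_coeff c 0 j = (\<lambda>x. if j = 0 then 1 else 0)"
| "chain_coeff c (Suc k) j = (\<lambda>x. chain_coeff c k j x +
     (case j of 0 \<Rightarrow> 0 | Suc i \<Rightarrow> deriv (chain_coeff c k i) x + c k x * chain_coeff c k i x))"

lemma chain_coeff_leading: "chain_coeff c k 0 = (\<lambda>_. 1)"
  by (induction k) auto

lemma chain_coeff_beyond: "k < j \<Longrightarrow> chain_coeff c k j = (\<lambda>_. 0)"
  by (induction k arbitrary: j) (auto split: nat.split)

lemma chain_coeff_second: "chain_coeff c k 1 x = (\<Sum>i<k. c i x)"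
  by (induction k) (auto simp: chain_coeff_leading)

lemma smooth_on_chain_coeff:
  assumes "open S" "\<And>i. smooth_on S (c i)"
  shows "smooth_on S (chain_coeff c k j)"
proof (induction k arbitrary: j)
  case 0
  show ?case by (simp add: smooth_on_const)
next
  case (Suc k)
  note smooth_on_add[OF assms(1) Suc
      smooth_on_add[OF assms(1) smooth_on_deriv[OF Suc] smooth_on_mult[OF assms(1,2) Suc]]]
  then show ?case using Suc by (cases j) auto
qed

lemma chain_expansion:
  assumes "open S" "\<And>i. smooth_on S (c i)" "smooth_on S y" "x \<in> S"
  shows "chain c k y x = (\<Sum>j\<le>k. chain_coeff c k j x * (deriv ^^ (k - j)) y x)"
  using assms(4)
proof (induction k arbitrary: x)
  case (Suc k)
  let ?e = "chain_coeff c k" and ?y = "\<lambda>i. (deriv ^^ i) y"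
  have "((\<lambda>x. \<Sum>j\<le>k. ?e j x * ?y (k - j) x) has_real_derivative
      (\<Sum>j\<le>k. deriv (?e j) x * ?y (k - j) x + deriv (?y (k - j)) x * ?e j x)) (at x)"
    by (intro DERIV_sum DERIV_mult smooth_on_has_derivative[OF _ Suc.prems]
        smooth_on_chain_coeff smooth_on_higher_deriv assms)
  then have "deriv (chain c k y) x =
      (\<Sum>j\<le>k. deriv (?e j) x * ?y (k - j) x + deriv (?y (k - j)) x * ?e j x)"
    using deriv_cong_open[OF assms(1) Suc.IH Suc.prems] by (simp add: DERIV_imp_deriv)
  also have "\<dots> = (\<Sum>j\<le>k. deriv (?e j) x * ?y (k - j) x) + (\<Sum>j\<le>k. ?e j x * ?y (Suc k - j) x)"
    by (auto simp: sum.distrib Suc_diff_le intro!: sum.cong)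
  finally have "chain c (Suc k) y x = (\<Sum>j\<le>k. ?e j x * ?y (Suc k - j) x)
      + (\<Sum>j\<le>k. (deriv (?e j) x + c k x * ?e j x) * ?y (k - j) x)"
    using Suc by (simp add: sum_distrib_left sum.distrib algebra_simps)
  also have "(\<Sum>j\<le>k. ?e j x * ?y (Suc k - j) x) = (\<Sum>j\<le>Suc k. ?e j x * ?y (Suc k - j) x)"
    by (simp add: chain_coeff_beyond)
  also have "(\<Sum>j\<le>k. (deriv (?e j) x + c k x * ?e j x) * ?y (k - j) x) =
      (\<Sum>j\<le>Suc k. (case j of 0 \<Rightarrow> 0 | Suc i \<Rightarrow> deriv (?e i) x + c k x * ?e i x) * ?y (Suc k - j) x)"
    by (subst sum.atMost_Suc_shift) simp
  also have "(\<Sum>j\<le>Suc k. ?e j x * ?y (Suc k - j) x) + \<dots> =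
      (\<Sum>j\<le>Suc k. chain_coeff c (Suc k) j x * ?y (Suc k - j) x)"
    by (simp only: chain_coeff.simps distrib_right sum.distrib)
  finally show ?case .
qed simp

lemma higher_deriv_shifted_power:
  "(deriv ^^ k) (\<lambda>x. (x - a) ^ i) =
    (\<lambda>x::real. if k \<le> i then fact i / fact (i - k) * (x - a) ^ (i - k) else 0)"
proof (induction k)
  case (Suc k)
  show ?case
  proof (cases "k < i")
    case True
    then obtain d where d: "i - k = Suc d" "i - Suc k = d"
      by (metis Suc_diff_Suc)
    have "((\<lambda>x. fact i / fact (Suc d) * (x - a) ^ Suc d) has_real_derivative
        fact i / fact d * (x - a) ^ d) (at x)" for x
    proof -
      have "((\<lambda>x. fact i / fact (Suc d) * (x - a) ^ Suc d) has_real_derivative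
          fact i / fact (Suc d) * (real (Suc d) * (x - a) ^ d)) (at x)"
        by (rule derivative_eq_intros refl | simp)+
      moreover have "fact i / fact (Suc d) * (real (Suc d) * t) = fact i / fact d * t" for t :: real
        by (simp only: fact_Suc of_nat_mult of_nat_fact) (simp add: divide_simps del: of_nat_Suc)
      ultimately show ?thesis by simp
    qed
    then have "deriv (\<lambda>x. fact i / fact (Suc d) * (x - a) ^ Suc d) =
        (\<lambda>x. fact i / fact d * (x - a) ^ d)"
      by (intro ext DERIV_imp_deriv)
    then show ?thesis using True by (simp only: funpow.simps o_apply Suc) (simp add: d)
  qed (use Suc in \<open>cases "k = i"; simp\<close>)
qed auto

lemma higher_deriv_shifted_power_at:
  "(deriv ^^ k) (\<lambda>x. (x - a) ^ i) a = (if k = i then fact i else (0::real))"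
  by (auto simp: higher_deriv_shifted_power)

lemma smooth_on_shifted_power: "smooth_on S (\<lambda>x. (x - a) ^ i)"
proof -
  have "((\<lambda>x. if k \<le> i then C * (x - a) ^ (i - k) else 0) has_real_derivative
     (if k \<le> i then C * (real (i - k) * (x - a) ^ (i - k - 1)) else 0)) (at x)" for k x and C :: real
    by (cases "k \<le> i") (auto intro!: derivative_eq_intros)
  then show ?thesis
    unfolding smooth_on_def higher_deriv_shifted_power field_differentiable_def by blast
qed

text \<open>
  The test functions \<open>(t - x)\<^sup>n\<^sup>-\<^sup>j\<close> have only one nonzero derivative at \<open>x\<close>, of order \<open>n - j\<close>, and
  so isolate the \<open>j\<close>-th coefficient there.
\<close>
lemma chain_coeff_unique:
  assumes "open S" "\<And>i. smooth_on S (c i)" "x \<in> S" "n \<ge> 1"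
    and eq: "\<And>y. smooth_on S y \<Longrightarrow> R * chain c n y x = M * normal_form n A y x"
  shows "R = M" "R * chain_coeff c n 1 x = 0"
    "2 \<le> n \<Longrightarrow> R * chain_coeff c n 2 x = M * A 2 x"
proof -
  \<comment> \<open>the full list of coefficients of the normal form, including the 1 and the 0 left implicit there\<close>
  define B where "B j = (if j = 0 then 1 else if j = 1 then 0 else A j x)" for j
  have B: "normal_form n A y x = (\<Sum>j\<le>n. B j * (deriv ^^ (n - j)) y x)" for y
  proof -
    have "{..n} = insert 0 (insert 1 {2..n})" using assms(4) by auto
    then show ?thesis by (auto simp: normal_form_def B_def)
  qed
  have pick: "(\<Sum>i\<le>n. f i * (deriv ^^ (n - i)) (\<lambda>t. (t - x) ^ (n - j)) x) = f j * fact (n - j)"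
    if "j \<le> n" for f j
  proof -
    have "(\<Sum>i\<le>n. f i * (deriv ^^ (n - i)) (\<lambda>t. (t - x) ^ (n - j)) x) =
        (\<Sum>i\<le>n. if i = j then f j * fact (n - j) else 0)"
      using that by (intro sum.cong) (auto simp: higher_deriv_shifted_power_at)
    then show ?thesis using that by simp
  qed
  have main: "R * chain_coeff c n j x = M * B j" if "j \<le> n" for j
  proof -
    let ?y = "\<lambda>t. (t - x) ^ (n - j)"
    have "chain c n ?y x = chain_coeff c n j x * fact (n - j)"
      using pick[OF that] by (subst chain_expansion[OF assms(1,2) smooth_on_shifted_power assms(3)])
    moreover have "normal_form n A ?y x = B j * fact (n - j)"
      using pick[OF that] by (subst B)
    ultimately have "R * (chain_coeff c n j x * fact (n - j)) = M * (B j * fact (n - j))"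
      using eq[OF smooth_on_shifted_power, of x "n - j"] by simp
    then show ?thesis by simp
  qed
  show "R = M" using main[of 0] by (simp add: B_def chain_coeff_leading)
  show "R * chain_coeff c n 1 x = 0" using main[of 1] assms(4) by (simp add: B_def)
  show "R * chain_coeff c n 2 x = M * A 2 x" if "2 \<le> n" using main[OF that] by (simp add: B_def)
qed

text \<open>
  Moving the power \<open>r\<^sup>k\<close> to the left of the next factor \<open>r D + s\<close> costs the logarithmic derivative
  \<open>k r'/r\<close>; this is where the weights in arithmetic progression come from.
\<close>
lemma Psi_funpow_eq_chain:
  assumes "open S" "smooth_on S r" "smooth_on S s" "smooth_on S y"
    and nz: "\<And>x. x \<in> S \<Longrightarrow> r x \<noteq> 0" and "x \<in> S"
  shows "(Psi r s ^^ k) y x =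
    r x ^ k * chain (\<lambda>i x. s x / r x + real i * (deriv r x / r x)) k y x"
  using assms(6)
proof (induction k arbitrary: x)
  case (Suc k)
  let ?c = "\<lambda>i x. s x / r x + real i * (deriv r x / r x)"
  let ?P = "chain ?c k y"
  have c: "smooth_on S (?c i)" for i
    by (intro smooth_on_add smooth_on_mult smooth_on_divide smooth_on_const smooth_on_deriv assms nz)
  have "((\<lambda>x. r x ^ k * ?P x) has_real_derivative
      real k * (deriv r x * r x ^ (k - 1)) * ?P x + deriv ?P x * r x ^ k) (at x)"
    using smooth_on_has_derivative[OF smooth_on_chain[OF assms(1) c assms(4)] Suc.prems]
      smooth_on_has_derivative[OF assms(2) Suc.prems]
    by (auto intro!: derivative_eq_intros)
  then have "deriv ((Psi r s ^^ k) y) x =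
      real k * (deriv r x * r x ^ (k - 1)) * ?P x + deriv ?P x * r x ^ k"
    using deriv_cong_open[OF assms(1) Suc.IH Suc.prems] by (simp add: DERIV_imp_deriv)
  moreover have "real k * (deriv r x * r x ^ (k - 1)) = real k * (deriv r x / r x) * r x ^ k"
    using nz[OF Suc.prems] by (cases k) auto
  ultimately have "deriv ((Psi r s ^^ k) y) x =
      r x ^ k * (deriv ?P x + real k * (deriv r x / r x) * ?P x)"
    by (simp only:) (simp only: algebra_simps)
  moreover have "s x = r x * (s x / r x)" using nz[OF Suc.prems] by simp
  ultimately have "(Psi r s ^^ Suc k) y x =
      r x * (r x ^ k * (deriv ?P x + real k * (deriv r x / r x) * ?P x))
      + r x * (s x / r x) * (r x ^ k * ?P x)"
    using Suc.IH[OF Suc.prems] by (simp add: Psi_def[of r s "(Psi r s ^^ k) y"])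
  also have "\<dots> = r x ^ Suc k * chain ?c (Suc k) y x"
    by (simp only: chain.simps power_Suc) (simp only: algebra_simps)
  finally show ?case .
qed simp

section \<open>Symmetric powers of the source equation\<close>

text \<open>
  With \<open>p = u'/u\<close> the factor \<open>D - (m - 2i)p\<close> is \<open>D\<close> conjugated by \<open>u\<close> to the power \<open>m - 2i\<close>.
\<close>
definition riccati_weight :: "real \<Rightarrow> (real \<Rightarrow> real) \<Rightarrow> nat \<Rightarrow> real \<Rightarrow> real" where
  "riccati_weight m p i x = - (m - 2 * real i) * p x"

text \<open>
  For \<open>k = m + 1\<close> this is the \<open>m\<close>-th symmetric power of \<open>y'' + q y = 0\<close>, the equation solved by the
  products of \<open>m\<close> of its solutions.  At \<open>k = 0\<close> the truncated index \<open>k - 1\<close> is harmless, as the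
  factor \<open>k\<close> vanishes.
\<close>
fun sym_power :: "(real \<Rightarrow> real) \<Rightarrow> real \<Rightarrow> nat \<Rightarrow> ode" where
  "sym_power q m 0 y = y"
| "sym_power q m (Suc k) y = (\<lambda>x. deriv (sym_power q m k y) x
     + real k * (m - real k + 1) * q x * sym_power q m (k - 1) y x)"

text \<open>
  If \<open>u'' + q u = 0\<close>, applying the recursion \<open>k\<close> times to \<open>u\<^sup>m\<close> gives
  \<open>m(m-1)\<cdots>(m-k+1) u\<^sup>m\<^sup>-\<^sup>k u'\<^sup>k\<close>.  These numbers are the analogous coefficients when it is applied
  to \<open>u\<^sup>m w(z)\<close>, in which the \<open>i\<close>-th derivative of \<open>w\<close> occurs.
\<close>
definition sym_coeff :: "real \<Rightarrow> nat \<Rightarrow> nat \<Rightarrow> real" where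
  "sym_coeff m k i = real (k choose i) * (\<Prod>l=i..<k. m - real l)"

lemma sym_coeff_diag: "sym_coeff m k k = 1"
  by (simp add: sym_coeff_def)

lemma sym_coeff_beyond: "k < i \<Longrightarrow> sym_coeff m k i = 0"
  by (simp add: sym_coeff_def)

lemma sym_coeff_Suc_0: "sym_coeff m (Suc k) 0 = (m - real k) * sym_coeff m k 0"
  by (simp add: sym_coeff_def)

lemma sym_coeff_Suc_Suc:
  assumes "j \<le> k"
  shows "sym_coeff m (Suc k) (Suc j) =
    (m - real k - real (Suc j)) * sym_coeff m k (Suc j) + sym_coeff m k j"
proof (cases "j = k")
  case True
  then show ?thesis by (simp add: sym_coeff_def)
next
  case False
  then have j: "j < k" using assms by simp
  define Q where "Q = (\<Prod>l=Suc j..<k. m - real l)"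
  have 1: "(\<Prod>l=j..<k. m - real l) = (m - real j) * Q"
    unfolding Q_def by (rule prod.atLeast_Suc_lessThan[OF j])
  have 2: "(\<Prod>l=Suc j..<Suc k. m - real l) = Q * (m - real k)"
    unfolding Q_def using j by (simp add: prod.atLeastLessThan_Suc)
  have "(k - j) * (k choose j) = Suc j * (k choose Suc j)"
    by (simp only: binomial_absorb_comp binomial_absorption)
  then have "real ((k - j) * (k choose j)) = real (Suc j * (k choose Suc j))" by (rule arg_cong)
  then have 3: "(real k - real j) * real (k choose j) = (1 + real j) * real (k choose Suc j)"
    using j by (simp add: of_nat_diff distrib_right)
  have "real (Suc k choose Suc j) * (m - real k) =
      (m - real k - real (Suc j)) * real (k choose Suc j) + real (k choose j) * (m - real j)"
    using 3 by (simp add: algebra_simps)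
  then have "real (Suc k choose Suc j) * (m - real k) * Q =
      ((m - real k - real (Suc j)) * real (k choose Suc j) + real (k choose j) * (m - real j)) * Q"
    by (rule arg_cong)
  then show ?thesis
    unfolding sym_coeff_def 1 2 Q_def[symmetric] by (simp only: algebra_simps)
qed

lemma sym_coeff_absorb:
  assumes "i \<le> k"
  shows "real (Suc k - i) * sym_coeff m (Suc k) i = real (Suc k) * (m - real k) * sym_coeff m k i"
proof -
  have "(Suc k - i) * (Suc k choose i) = Suc k * (k choose i)"
    by (simp only: binomial_absorb_comp diff_Suc_1)
  then have "real ((Suc k - i) * (Suc k choose i)) = real (Suc k * (k choose i))" by (rule arg_cong)
  then have "real (Suc k - i) * real (Suc k choose i) = real (Suc k) * real (k choose i)"
    by (simp only: of_nat_mult)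
  moreover have "(\<Prod>l=i..<Suc k. m - real l) = (\<Prod>l=i..<k. m - real l) * (m - real k)"
    using assms by (simp add: prod.atLeastLessThan_Suc)
  ultimately show ?thesis
    unfolding sym_coeff_def by (simp only: mult.assoc[symmetric]) (simp add: algebra_simps)
qed

text \<open>
  Differentiating the sum, the Riccati equation splits \<open>p'\<close> into two parts: the terms with \<open>q\<close>
  are cancelled by the correction term of the recursion (\<open>sym_coeff_absorb\<close>), and the terms free
  of \<open>q\<close> combine by a Pascal rule (\<open>sym_coeff_Suc_Suc\<close>).
\<close>
lemma sym_power_riccati_expansion:
  assumes "open S" "smooth_on S p" "smooth_on S y"
    and riccati: "\<And>x. x \<in> S \<Longrightarrow> deriv p x = - q x - (p x)\<^sup>2"
    and "x \<in> S"
  shows "sym_power q m k y x =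
    (\<Sum>i\<le>k. sym_coeff m k i * p x ^ (k - i) * chain (riccati_weight m p) i y x)"
  using assms(5)
proof (induction k arbitrary: x rule: less_induct)
  case (less k)
  let ?P = "\<lambda>i. chain (riccati_weight m p) i y"
  have w: "smooth_on S (riccati_weight m p i)" for i
    unfolding riccati_weight_def by (intro smooth_on_mult smooth_on_const assms)
  have P: "(?P i has_real_derivative ?P (Suc i) x + (m - 2 * real i) * p x * ?P i x) (at x)" for i
  proof -
    have "smooth_on S (?P i)" by (rule smooth_on_chain[OF assms(1) w assms(3)])
    from smooth_on_has_derivative[OF this less.prems] show ?thesis
      by (simp add: riccati_weight_def algebra_simps)
  qed
  show ?case
  proof (cases k)
    case 0
    then show ?thesis by (simp add: sym_coeff_def)
  next
    case (Suc k')
    have p: "(p has_real_derivative - q x - (p x)\<^sup>2) (at x)"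
      using smooth_on_has_derivative[OF assms(2) less.prems] riccati[OF less.prems] by simp
    let ?T = "\<lambda>x. \<Sum>i\<le>k'. sym_coeff m k' i * p x ^ (k' - i) * ?P i x"
    have "((\<lambda>x. sym_coeff m k' i * p x ^ (k' - i) * ?P i x) has_real_derivative
        sym_coeff m k' i * p x ^ (k' - i) * ?P (Suc i) x
        + (m - real k' - real i) * sym_coeff m k' i * p x ^ (Suc k' - i) * ?P i x
        - q x * (real (k' - i) * sym_coeff m k' i * p x ^ (k' - 1 - i) * ?P i x)) (at x)"
      if "i \<le> k'" for i
    proof -
      note D = DERIV_mult[OF DERIV_cmult[where c = "sym_coeff m k' i",
            OF DERIV_power[where n = "k' - i", OF p]] P[of i]]
      show ?thesis
      proof (rule DERIV_cong[OF D])
        obtain d where d: "k' = i + d" using \<open>i \<le> k'\<close> le_Suc_ex by blast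
        define C X Y where "C = sym_coeff m k' i" and "X = ?P i x" and "Y = ?P (Suc i) x"
        show "C * (real (k' - i) * ((- q x - (p x)\<^sup>2) * p x ^ (k' - i - Suc 0))) * X
            + (Y + (m - 2 * real i) * p x * X) * (C * p x ^ (k' - i))
          = C * p x ^ (k' - i) * Y + (m - real k' - real i) * C * p x ^ (Suc k' - i) * X
            - q x * (real (k' - i) * C * p x ^ (k' - 1 - i) * X)"
          unfolding d by (cases d) (simp_all add: algebra_simps power2_eq_square)
      qed
    qed
    then have "(?T has_real_derivative
        (\<Sum>i\<le>k'. sym_coeff m k' i * p x ^ (k' - i) * ?P (Suc i) x
        + (m - real k' - real i) * sym_coeff m k' i * p x ^ (Suc k' - i) * ?P i x
        - q x * (real (k' - i) * sym_coeff m k' i * p x ^ (k' - 1 - i) * ?P i x))) (at x)"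
      by (intro DERIV_sum) simp
    moreover have "deriv (sym_power q m k' y) x = deriv ?T x"
      by (rule deriv_cong_open[OF assms(1) _ less.prems]) (use less.IH Suc in auto)
    ultimately have 1: "deriv (sym_power q m k' y) x =
        (\<Sum>i\<le>k'. sym_coeff m k' i * p x ^ (k' - i) * ?P (Suc i) x)
        + (\<Sum>i\<le>k'. (m - real k' - real i) * sym_coeff m k' i * p x ^ (Suc k' - i) * ?P i x)
        - q x * (\<Sum>i\<le>k'. real (k' - i) * sym_coeff m k' i * p x ^ (k' - 1 - i) * ?P i x)"
      by (simp add: DERIV_imp_deriv sum.distrib sum_subtractf sum_distrib_left)
    have 2: "(\<Sum>i\<le>k'. real (k' - i) * sym_coeff m k' i * p x ^ (k' - 1 - i) * ?P i x) =
        real k' * (m - real k' + 1) * sym_power q m (k' - 1) y x"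
    proof (cases k')
      case 0
      then show ?thesis by simp
    next
      case (Suc l)
      have "(\<Sum>i\<le>Suc l. real (Suc l - i) * sym_coeff m (Suc l) i * p x ^ (l - i) * ?P i x) =
          (\<Sum>i\<le>l. real (Suc l - i) * sym_coeff m (Suc l) i * p x ^ (l - i) * ?P i x)"
        by simp
      also have "\<dots> = (\<Sum>i\<le>l. real (Suc l) * (m - real l) * (sym_coeff m l i * p x ^ (l - i) * ?P i x))"
        by (intro sum.cong refl) (simp only: sym_coeff_absorb atMost_iff mult.assoc[symmetric])
      also have "\<dots> = real (Suc l) * (m - real l) * sym_power q m l y x"
        using less.IH[of l x] less.prems Suc \<open>k = Suc k'\<close> by (simp add: sum_distrib_left)
      finally show ?thesis using Suc by simp
    qed
    have "(\<Sum>i\<le>Suc k'. sym_coeff m (Suc k') i * p x ^ (Suc k' - i) * ?P i x) =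
        (m - real k') * sym_coeff m k' 0 * p x ^ Suc k' * ?P 0 x
        + (\<Sum>i\<le>k'. ((m - real k' - real (Suc i)) * sym_coeff m k' (Suc i) + sym_coeff m k' i)
            * p x ^ (k' - i) * ?P (Suc i) x)"
      by (subst sum.atMost_Suc_shift) (simp add: sym_coeff_Suc_0 sym_coeff_Suc_Suc del: chain.simps)
    also have "\<dots> = (\<Sum>i\<le>Suc k'. (m - real k' - real i) * sym_coeff m k' i * p x ^ (Suc k' - i) * ?P i x)
        + (\<Sum>i\<le>k'. sym_coeff m k' i * p x ^ (k' - i) * ?P (Suc i) x)"
      by (subst sum.atMost_Suc_shift) (simp add: distrib_right sum.distrib del: chain.simps)
    also have "(\<Sum>i\<le>Suc k'. (m - real k' - real i) * sym_coeff m k' i * p x ^ (Suc k' - i) * ?P i x) =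
        (\<Sum>i\<le>k'. (m - real k' - real i) * sym_coeff m k' i * p x ^ (Suc k' - i) * ?P i x)"
      by (simp add: sym_coeff_beyond)
    finally show ?thesis
      unfolding Suc sym_power.simps 1 2 by (simp del: chain.simps)
  qed
qed

text \<open>
  At \<open>k = m + 1\<close> every coefficient with \<open>i \<le> m\<close> contains the factor \<open>m - m\<close>, so only the full
  product survives in the expansion.  As the right-hand side is free of \<open>p\<close>, all solutions \<open>p\<close> of
  the Riccati equation give the same operator.
\<close>
lemma chain_riccati_eq_sym_power:
  assumes "open S" "smooth_on S p" "smooth_on S y"
    and "\<And>x. x \<in> S \<Longrightarrow> deriv p x = - q x - (p x)\<^sup>2"
    and "x \<in> S"
  shows "chain (riccati_weight (real m) p) (Suc m) y x = sym_power q (real m) (Suc m) y x"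
proof -
  have "sym_coeff (real m) (Suc m) i = 0" if "i \<le> m" for i
    using that by (auto simp: sym_coeff_def)
  then show ?thesis
    using sym_power_riccati_expansion[OF assms, of "real m" "Suc m"]
    by (simp add: sym_coeff_diag del: chain.simps)
qed

text \<open>
  The weight of each factor is chosen to cancel the derivative of the power of \<open>u\<close> in front;
  what remains is \<open>w'(z) z'\<close> with \<open>z' = 1/u\<^sup>2\<close>.  The exponent becomes negative on the way, hence
  the integer power.
\<close>
lemma chain_riccati_point_transformation:
  assumes "open S" "smooth_on S u" "\<And>x. x \<in> S \<Longrightarrow> u x \<noteq> 0"
    and z: "\<And>x. x \<in> S \<Longrightarrow> (z has_real_derivative 1 / (u x)\<^sup>2) (at x)"
    and "smooth_on (z ` S) w" "x \<in> S"
  shows "chain (riccati_weight (real m) (\<lambda>x. deriv u x / u x)) k (\<lambda>x. a * u x ^ m * w (z x)) x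
    = a * u x powi (int m - 2 * int k) * (deriv ^^ k) w (z x)"
  using assms(6)
proof (induction k arbitrary: x)
  case (Suc k)
  note u = smooth_on_has_derivative[OF assms(2) Suc.prems] and nz = assms(3)[OF Suc.prems]
  have W: "((deriv ^^ k) w has_real_derivative (deriv ^^ Suc k) w (z x)) (at (z x))"
    using smooth_on_has_derivative[OF smooth_on_higher_deriv[OF assms(5)]] Suc.prems by simp
  let ?e = "int m - 2 * int k"
  have e: "u x powi (?e - 1) = u x powi ?e / u x" "u x powi (?e - 2) = u x powi ?e / (u x)\<^sup>2"
    using nz by (simp_all add: power_int_diff power2_eq_square)
  have "((\<lambda>x. a * u x powi ?e * (deriv ^^ k) w (z x)) has_real_derivative
      a * (of_int ?e * u x powi (?e - 1) * deriv u x) * (deriv ^^ k) w (z x)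
      + (deriv ^^ Suc k) w (z x) * (1 / (u x)\<^sup>2) * (a * u x powi ?e)) (at x)"
    using DERIV_mult[OF DERIV_cmult[where c = a, OF DERIV_power_int[where n = ?e, OF u disjI2[OF nz]]]
        DERIV_chain2[OF W z[OF Suc.prems]]] by simp
  then have "deriv (chain (riccati_weight (real m) (\<lambda>x. deriv u x / u x)) k
      (\<lambda>x. a * u x ^ m * w (z x))) x =
      a * (of_int ?e * u x powi (?e - 1) * deriv u x) * (deriv ^^ k) w (z x)
      + (deriv ^^ Suc k) w (z x) * (1 / (u x)\<^sup>2) * (a * u x powi ?e)"
    using deriv_cong_open[OF assms(1) Suc.IH Suc.prems] by (simp add: DERIV_imp_deriv)
  moreover have "int m - 2 * int (Suc k) = ?e - 2" by simp
  moreover have "riccati_weight (real m) (\<lambda>x. deriv u x / u x) k x = - of_int ?e * (deriv u x / u x)"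
    by (simp add: riccati_weight_def)
  ultimately show ?case
    unfolding chain.simps Suc.IH[OF Suc.prems]
    by (simp only: e) (simp add: diff_divide_distrib add_divide_distrib algebra_simps)
qed simp

section \<open>Iterative equations in normal form\<close>

text \<open>
  The closed form for arbitrary \<open>k\<close> is what the induction needs; it is used for \<open>k = m + 1\<close> only,
  where it collapses to \<open>-(m+2 choose 3)(p' + p\<^sup>2)\<close>.
\<close>
lemma chain_coeff_riccati:
  assumes "open S" "smooth_on S p" "x \<in> S"
  shows "chain_coeff (riccati_weight m p) k 2 x =
    real k * (real k - 1) * ((2 * real k - 4 - 3 * m) * deriv p x
      + (3 * real k * (real k - 1) - (2 + 3 * m) * (2 * real k - 1) + 3 * m * (m + 1)) * (p x)\<^sup>2) / 6"
proof (induction k)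
  case (Suc k)
  have "chain_coeff (riccati_weight m p) k 1 = (\<lambda>x. real k * (real k - 1 - m) * p x)"
  proof
    fix x
    show "chain_coeff (riccati_weight m p) k 1 x = real k * (real k - 1 - m) * p x"
      unfolding chain_coeff_second by (induction k) (simp_all add: riccati_weight_def algebra_simps)
  qed
  then have second: "chain_coeff (riccati_weight m p) k (Suc 0) = (\<lambda>x. real k * (real k - 1 - m) * p x)"
    by simp
  have "deriv (\<lambda>x. real k * (real k - 1 - m) * p x) x = real k * (real k - 1 - m) * deriv p x"
    by (intro DERIV_imp_deriv DERIV_cmult smooth_on_has_derivative[OF assms(2,3)])
  then have "chain_coeff (riccati_weight m p) (Suc k) 2 x = chain_coeff (riccati_weight m p) k 2 x
      + real k * (real k - 1 - m) * deriv p x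
      - (m - 2 * real k) * (real k * (real k - 1 - m)) * (p x)\<^sup>2"
    by (simp add: numeral_2_eq_2 second riccati_weight_def) (simp add: algebra_simps)
  then show ?case
    unfolding Suc of_nat_Suc by (simp add: field_simps power2_eq_square)
qed simp

lemma real_choose_three: "real ((m + 2) choose 3) = real m * (real m + 1) * (real m + 2) / 6"
proof -
  have "3 * ((m + 2) choose 3) = (m + 2) * ((m + 1) choose 2)"
    using Suc_times_binomial[of 2 "m + 1"] by (simp add: numeral_3_eq_3 numeral_2_eq_2)
  then have "6 * ((m + 2) choose 3) = (m + 2) * (2 * ((m + 1) choose 2))" by simp
  also have "2 * ((m + 1) choose 2) = (m + 1) * m"
    using Suc_times_binomial[of 1 m] by (simp add: numeral_2_eq_2)
  finally have "6 * ((m + 2) choose 3) = (m + 2) * ((m + 1) * m)" .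
  then have "real (6 * ((m + 2) choose 3)) = real ((m + 2) * ((m + 1) * m))" by (rule arg_cong)
  then show ?thesis by (simp add: field_simps)
qed

text \<open>
  The coefficients are compared twice: the second one determines \<open>s\<close> in terms of \<open>r\<close> on all of \<open>S\<close>,
  and only then do the factors have Riccati weights, for which the third coefficient is known.
\<close>
lemma iterative_normal_form_eq_sym_power:
  assumes "iterative S (Suc m) (normal_form (Suc m) A)" "m \<ge> 1" "open S"
    "smooth_on S y" "x \<in> S"
  shows "normal_form (Suc m) A y x = sym_power (source_coeff (Suc m) A) (real m) (Suc m) y x"
proof -
  let ?n = "Suc m"
  obtain r s \<mu> where r: "smooth_on S r" "\<And>x. x \<in> S \<Longrightarrow> r x \<noteq> 0" and s: "smooth_on S s"
    and Psi: "\<And>y x. smooth_on S y \<Longrightarrow> x \<in> S \<Longrightarrow> (Psi r s ^^ ?n) y x = \<mu> x * normal_form ?n A y x"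
    using assms(1) unfolding iterative_def same_equation_def by blast
  define c where "c i x = s x / r x + real i * (deriv r x / r x)" for i x
  define p where "p x = deriv r x / (2 * r x)" for x
  have c: "smooth_on S (c i)" for i
    unfolding c_def
    by (intro smooth_on_add smooth_on_mult smooth_on_divide smooth_on_const smooth_on_deriv assms r s)
  have p: "smooth_on S p"
    unfolding p_def using r(2)
    by (intro smooth_on_divide smooth_on_mult smooth_on_const smooth_on_deriv assms r(1)) auto
  have w: "smooth_on S (riccati_weight m p i)" for i
    unfolding riccati_weight_def by (intro smooth_on_mult smooth_on_const assms p)
  have chain: "r x ^ ?n * chain c ?n y x = \<mu> x * normal_form ?n A y x"
    if "smooth_on S y" "x \<in> S" for x y
    using Psi[OF that] Psi_funpow_eq_chain[OF assms(3) r(1) s that(1) r(2) that(2), of ?n]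
    unfolding c_def by simp
  have weight: "c i x = riccati_weight m p i x" if "x \<in> S" for i x
  proof -
    have "r x ^ ?n * chain_coeff c ?n 1 x = 0"
      by (rule chain_coeff_unique(2)[OF assms(3) c that _ chain[OF _ that]]) simp_all
    then have "(\<Sum>i<?n. c i x) = 0"
      using r(2)[OF that] by (simp only: chain_coeff_second mult_eq_0_iff power_eq_0_iff) simp
    have c_p: "c i x = s x / r x + 2 * real i * p x" for i
      by (simp add: c_def p_def)
    have "(\<Sum>i<k. c i x) = real k * (s x / r x + (real k - 1) * p x)" for k
      by (induction k) (simp_all add: c_p algebra_simps add_divide_distrib)
    from this[of ?n] have "real ?n * (s x / r x + real m * p x) = 0"
      using \<open>(\<Sum>i<?n. c i x) = 0\<close> by simp
    then have "s x / r x + real m * p x = 0" by (simp only: mult_eq_0_iff of_nat_eq_0_iff) simp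
    then show ?thesis by (simp add: c_p riccati_weight_def algebra_simps)
  qed
  have riccati_chain: "chain (riccati_weight m p) ?n y x = normal_form ?n A y x"
    if "smooth_on S y" "x \<in> S" for x y
  proof -
    have "r x ^ ?n = \<mu> x"
      by (rule chain_coeff_unique(1)[OF assms(3) c that(2) _ chain[OF _ that(2)]]) simp_all
    then have "r x ^ ?n * chain c ?n y x = r x ^ ?n * normal_form ?n A y x"
      using chain[OF that] by simp
    moreover have "chain c ?n y x = chain (riccati_weight m p) ?n y x"
      by (rule chain_cong[OF assms(3) weight that(2)])
    ultimately show ?thesis using r(2)[OF that(2)] by simp
  qed
  have riccati: "deriv p x = - source_coeff ?n A x - (p x)\<^sup>2" if "x \<in> S" for x
  proof -
    have "1 * chain_coeff (riccati_weight m p) ?n 2 x = 1 * A 2 x"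
      by (rule chain_coeff_unique(3)[OF assms(3) w that])
        (use assms(2) in \<open>simp_all add: riccati_chain[OF _ that] del: chain.simps\<close>)
    then have "chain_coeff (riccati_weight m p) ?n 2 x = A 2 x" by (simp only: mult_1)
    then have "A 2 x = - (real ((m + 2) choose 3) * (deriv p x + (p x)\<^sup>2))"
      unfolding chain_coeff_riccati[OF assms(3) p that] real_choose_three
      by (simp add: field_simps)
    moreover have "real ((m + 2) choose 3) > 0"
      unfolding real_choose_three using assms(2) by simp
    ultimately show ?thesis
      by (simp add: source_coeff_def field_simps)
  qed
  show ?thesis
    using riccati_chain[OF assms(4,5)]
      chain_riccati_eq_sym_power[OF assms(3) p assms(4) riccati assms(5)] by simp
qed

theorem mainTheorem4:
  fixes n :: nat and I :: "real set" and A :: "nat \<Rightarrow> real \<Rightarrow> real"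
    and u z :: "real \<Rightarrow> real" and l :: real
  assumes "n \<ge> 2"
    and "open I" and "is_interval I"
    and "\<And>j. j \<in> {2..n} \<Longrightarrow> smooth_on I (A j)"
    and "iterative I n (normal_form n A)"
    and "smooth_on I u" and "\<And>x. x \<in> I \<Longrightarrow> u x \<noteq> 0"
    and "\<And>x. x \<in> I \<Longrightarrow> (deriv ^^ 2) u x + source_coeff n A x * u x = 0"
    and "\<And>x. x \<in> I \<Longrightarrow> (z has_real_derivative 1 / (u x)\<^sup>2) (at x)"
    and "l \<noteq> 0"
  shows "reduces_to I z (\<lambda>x. 1 / l * u x ^ (n - 1))
           (normal_form n A) (\<lambda>w. (deriv ^^ n) w)"
proof -
  obtain m where n: "n = Suc m" and m: "m \<ge> 1"
    using assms(1) by (cases n) auto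
  note op = \<open>open I\<close> and u = \<open>smooth_on I u\<close> and nz = assms(7) and z = assms(9)
  have deriv_z: "deriv z x = 1 / (u x)\<^sup>2" if "x \<in> I" for x
    by (rule DERIV_imp_deriv[OF z[OF that]])
  have smooth_z: "smooth_on I z"
    by (rule smooth_onI_deriv[OF op z])
      (use nz in \<open>auto intro!: smooth_on_divide smooth_on_const smooth_on_power op u\<close>)
  note inv = smooth_on_inverse_function[OF op \<open>is_interval I\<close> smooth_z]
  have pos: "deriv z x > 0" if "x \<in> I" for x
    using deriv_z[OF that] nz[OF that] by simp
  have smooth_h: "smooth_on I (\<lambda>x. 1 / l * u x ^ (n - 1))"
    by (intro smooth_on_mult smooth_on_const smooth_on_power op u)
  have "point_transformation I z (\<lambda>x. 1 / l * u x ^ (n - 1))"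
    unfolding point_transformation_def
    using smooth_z inv[OF pos] smooth_h nz \<open>l \<noteq> 0\<close> by simp

  let ?p = "\<lambda>x. deriv u x / u x"
  have smooth_p: "smooth_on I ?p"
    by (intro smooth_on_divide smooth_on_deriv op u nz)
  have riccati: "deriv ?p x = - source_coeff n A x - (?p x)\<^sup>2" if "x \<in> I" for x
  proof -
    have "(?p has_real_derivative
        (deriv (deriv u) x * u x - deriv u x * deriv u x) / (u x * u x)) (at x)"
      by (rule DERIV_divide[OF smooth_on_has_derivative[OF smooth_on_deriv[OF u] that]
            smooth_on_has_derivative[OF u that] nz[OF that]])
    moreover have "deriv (deriv u) x = - source_coeff n A x * u x"
      using assms(8)[OF that] by (simp add: numeral_2_eq_2)
    ultimately show ?thesis
      using nz[OF that] by (simp add: DERIV_imp_deriv field_simps power2_eq_square)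
  qed
  have eq: "normal_form n A (\<lambda>x. 1 / l * u x ^ (n - 1) * w (z x)) x =
      1 / l / u x ^ (n + 1) * (deriv ^^ n) w (z x)"
    if w: "smooth_on (z ` I) w" and x: "x \<in> I" for w x
  proof -
    let ?y = "\<lambda>x. 1 / l * u x ^ m * w (z x)"
    have "smooth_on I (\<lambda>x. w (z x))"
      by (rule smooth_on_compose[OF op w smooth_z]) simp
    from smooth_on_mult[OF op smooth_h this] have y: "smooth_on I ?y"
      by (simp add: n)
    have "normal_form n A ?y x = chain (riccati_weight m ?p) n ?y x"
      using iterative_normal_form_eq_sym_power[of I m A, OF _ m op y x] assms(5)
        chain_riccati_eq_sym_power[OF op smooth_p y riccati x, of m]
      by (simp add: n)
    also have "\<dots> = 1 / l * u x powi (int m - 2 * int n) * (deriv ^^ n) w (z x)"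
      by (rule chain_riccati_point_transformation[OF op u nz z w x])
    also have "int m - 2 * int n = - int (n + 1)" by (simp add: n)
    finally show ?thesis
      by (simp add: n power_int_minus divide_inverse del: of_nat_Suc of_nat_add)
  qed
  have "same_equation (z ` I)
      (transformed_equation I z (\<lambda>x. 1 / l * u x ^ (n - 1)) (normal_form n A)) ((^^) deriv n)"
    unfolding same_equation_def
  proof (intro exI[of _ "\<lambda>t. 1 / l / u (the_inv_into I z t) ^ (n + 1)"] conjI ballI allI impI)
    let ?x = "the_inv_into I z"
    have x: "?x t \<in> I" "z (?x t) = t" if "t \<in> z ` I" for t
      using that inv(1)[OF pos] by (auto simp: the_inv_into_f_f)
    have "smooth_on (z ` I) (\<lambda>t. u (?x t))"
      by (rule smooth_on_compose[OF inv(2)[OF pos] u inv(3)[OF pos] x(1)])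
    then show "smooth_on (z ` I) (\<lambda>t. 1 / l / u (?x t) ^ (n + 1))"
      by (intro smooth_on_divide smooth_on_const smooth_on_power inv(2)[OF pos])
        (use x nz \<open>l \<noteq> 0\<close> in auto)
    show "1 / l / u (?x t) ^ (n + 1) \<noteq> 0" if "t \<in> z ` I" for t
      using nz[OF x(1)[OF that]] \<open>l \<noteq> 0\<close> by simp
    show "transformed_equation I z (\<lambda>x. 1 / l * u x ^ (n - 1)) (normal_form n A) w t =
        1 / l / u (?x t) ^ (n + 1) * (deriv ^^ n) w t"
      if "smooth_on (z ` I) w" "t \<in> z ` I" for w t
      unfolding transformed_equation_def using eq[OF that(1) x(1)[OF that(2)]] x(2)[OF that(2)]
      by simp
  qed
  with \<open>point_transformation I z (\<lambda>x. 1 / l * u x ^ (n - 1))\<close> show ?thesis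
    by (simp add: reduces_to_def)
qed

end
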